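(* Let $\sigma_0>0$. The function $G(u)$ defined in the context (piecewise on the four pieces $Q_1,\dots,Q_4$ of the strip) is holomorphic in the open strip $\{u\in\mathbb{C}: |\Im(u)|<\pi\}$.
   Context: Let $\sigma_0>0$ and $h(s)=\frac{\sin(\frac{\sigma_0}{2}\sinh s)}{\sinh s}$, extended to an entire function of $s$ through its removable singularities (in particular $h(0)=\sigma_0/2$). Let $\sqrt{z}$ denote the principal square root (branch cut along the negative real axis), and let $(\sqrt z)_+$ be the square root with branch cut along the positive real axis: $$(\sqrt z)_+=\sqrt z\ \text{ if }\Im(z)\ge0,\qquad (\sqrt z)_+=-\sqrt z\ \text{ if }\Im(z)<0.$$ Here $\arg$ takes values in $[-\pi,\pi]$ (negative reals may be assigned either $\pi$ or $-\pi$; both lines below give the same value there). For $u\in Q_1=\{u:\arg(u)\in[0,\pi/2],\ \Im(u)<\pi\}$ define $$G_{Q1}(u)=\sinh u\int_0^u\frac{h(s)\,ds}{(\sqrt{\cosh u-\cosh s})_+},$$ where the integral is along the straight segment from $0$ to $u$, i.e. $G_{Q1}(u)=u\sinh u\int_0^1\frac{h(wu)\,dw}{(\sqrt{\cosh u-\cosh(wu)})_+}$, with $G_{Q1}(0)=0$. With $^*$ denoting complex conjugation, define $G$ on the strip $|\Im(u)|<\pi$ by - $G(u)=G_{Q1}(u)$ for $u\in Q_1$; - $G(u)=-(G_{Q1}(-u^* ))^*$ for $u\in Q_2=\{u:\arg(u)\in(\frac{\pi}{2},\pi],\ \Im(u)<\pi\}$; - $G(u)=-G_{Q1}(-u)$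 for $u\in Q_3=\{u:\arg(u)\in[-\pi,-\frac{\pi}{2}),\ |\Im(u)|<\pi\}$; - $G(u)=(G_{Q1}(u^* ))^*$ for $u\in Q_4=\{u:\arg(u)\in[-\frac{\pi}{2},0),\ |\Im(u)|<\pi\}$. *)

theory Defs
  imports "HOL-Complex_Analysis.Complex_Analysis"
begin

text \<open>
  Every zero of \<open>sinh\<close> is a removable singularity of \<open>sin (\<sigma> / 2 * sinh s) / sinh s\<close>, and the
  limit there is \<open>\<sigma> / 2\<close>; \<open>hfun_entire\<close> below confirms that this extension is entire.
\<close>
definition hfun :: "real \<Rightarrow> complex \<Rightarrow> complex" where
  "hfun \<sigma> s = (if sinh s = 0 then of_real (\<sigma> / 2) else sin (of_real (\<sigma> / 2) * sinh s) / sinh s)"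

lemma hfun_entire: "hfun \<sigma> holomorphic_on UNIV"
proof -
  define a where "a = complex_of_real (\<sigma> / 2)"
  define g where "g z = (if z = 0 then deriv (\<lambda>z. sin (a * z)) 0
      else (sin (a * z) - sin (a * 0)) / (z - 0))" for z :: complex
  have "(\<lambda>z. sin (a * z)) holomorphic_on UNIV"
    by (intro holomorphic_intros)
  then have g: "g holomorphic_on UNIV"
    unfolding g_def by (rule pole_lemma) auto
  have "((\<lambda>z. sin (a * z)) has_field_derivative a) (at 0)"
    by (auto intro!: derivative_eq_intros)
  then have d: "deriv (\<lambda>z. sin (a * z)) 0 = a"
    by (rule DERIV_imp_deriv)
  have "hfun \<sigma> = g \<circ> sinh"
    unfolding hfun_def a_def[symmetric] by (auto simp: fun_eq_iff g_def d)
  moreover have "(sinh :: complex \<Rightarrow> complex) holomorphic_on UNIV"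
    unfolding sinh_def scaleR_conv_of_real by (intro holomorphic_intros)
  ultimately show ?thesis
    using holomorphic_on_compose_gen[OF _ g] by auto
qed

text \<open>Branch of the square root cut along the positive real axis.\<close>
definition csqrt_plus :: "complex \<Rightarrow> complex" where
  "csqrt_plus z = (if Im z \<ge> 0 then csqrt z else - csqrt z)"

text \<open>
  The integrand is singular at the endpoint \<open>s = u\<close>; the singularity is integrable, and
  \<open>contour_integral\<close>, being based on the Henstock--Kurzweil integral, covers this case.
\<close>
definition G_Q1 :: "real \<Rightarrow> complex \<Rightarrow> complex" where
  "G_Q1 \<sigma> u = (if u = 0 then 0 else
     sinh u * contour_integral (linepath 0 u) (\<lambda>s. hfun \<sigma> s / csqrt_plus (cosh u - cosh s)))"

lemma G_Q1_altdef:
  "G_Q1 \<sigma> u = u * sinh u *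
     integral {0..1} (\<lambda>w. hfun \<sigma> (of_real w * u) / csqrt_plus (cosh u - cosh (of_real w * u)))"
proof -
  have "contour_integral (linepath 0 u) f = u * integral {0..1} (\<lambda>w. f (of_real w * u))" for f
    by (simp add: contour_integral_integral linepath_def scaleR_conv_of_real mult.commute)
  then show ?thesis
    by (simp add: G_Q1_def)
qed

definition Q1 :: "complex set" where
  "Q1 = {u. Arg u \<in> {0..pi / 2} \<and> Im u < pi}"

definition Q2 :: "complex set" where
  "Q2 = {u. Arg u \<in> {pi / 2<..pi} \<and> Im u < pi}"

definition Q3 :: "complex set" where
  "Q3 = {u. Arg u \<in> {- pi..<- pi / 2} \<and> \<bar>Im u\<bar> < pi}"

definition Q4 :: "complex set" where
  "Q4 = {u. Arg u \<in> {- pi / 2..<0} \<and> \<bar>Im u\<bar> < pi}"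

text \<open>
  \<open>Arg\<close> takes values in \<open>(-\<pi>, \<pi>]\<close> and \<open>Arg 0 = 0\<close>. So the origin lies in \<open>Q1\<close> and the negative
  reals lie in \<open>Q2\<close> only; on them the formula for \<open>Q3\<close> gives the same value (\<open>G_neg_real\<close>).
  The final value 0 is only taken outside the strip.
\<close>
definition G :: "real \<Rightarrow> complex \<Rightarrow> complex" where
  "G \<sigma> u =
     (if u \<in> Q1 then G_Q1 \<sigma> u
      else if u \<in> Q2 then - cnj (G_Q1 \<sigma> (- cnj u))
      else if u \<in> Q3 then - G_Q1 \<sigma> (- u)
      else if u \<in> Q4 then cnj (G_Q1 \<sigma> (cnj u))
      else 0)"

lemma strip_eq_Q: "{u. \<bar>Im u\<bar> < pi} = Q1 \<union> Q2 \<union> Q3 \<union> Q4"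
proof -
  have "u \<in> Q1 \<union> Q2 \<union> Q3 \<union> Q4" if "\<bar>Im u\<bar> < pi" for u
    using that Arg_bounded[of u] by (auto simp: Q1_def Q2_def Q3_def Q4_def)
  moreover have "\<bar>Im u\<bar> < pi" if "u \<in> Q1 \<union> Q2 \<union> Q3 \<union> Q4" for u
  proof (cases "Arg u \<ge> 0")
    case True
    then have "Im u \<ge> 0"
      by (metis Arg_less_0 linorder_not_le)
    with that show ?thesis
      by (auto simp: Q1_def Q2_def Q3_def Q4_def)
  next
    case False
    with that show ?thesis
      by (auto simp: Q1_def Q2_def Q3_def Q4_def)
  qed
  ultimately show ?thesis by blast
qed

lemma G_neg_real:
  assumes "x < 0"
  shows "- cnj (G_Q1 \<sigma> (- cnj (of_real x))) = - G_Q1 \<sigma> (- of_real x)"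
proof -
  define y where "y = - x"
  have sinh_r: "sinh (complex_of_real t) = of_real (sinh t)" for t
    by (simp add: sinh_def scaleR_conv_of_real flip: exp_of_real of_real_minus)
  have cosh_r: "cosh (complex_of_real t) = of_real (cosh t)" for t
    by (simp add: cosh_def scaleR_conv_of_real flip: exp_of_real of_real_minus)
  have "hfun \<sigma> (of_real t) = of_real (if sinh t = 0 then \<sigma> / 2 else sin (\<sigma> / 2 * sinh t) / sinh t)" for t
    unfolding hfun_def sinh_r of_real_mult[symmetric] sin_of_real by simp
  then have h_r: "cnj (hfun \<sigma> (of_real t)) = hfun \<sigma> (of_real t)" for t
    by simp
  have s_r: "cnj (csqrt_plus (of_real t)) = csqrt_plus (of_real t)" if "t \<ge> 0" for t
    using that by (simp add: csqrt_plus_def of_real_sqrt[symmetric])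
  have "cosh (w * y) \<le> cosh y" if "w \<in> {0..1}" for w
  proof -
    have "0 \<le> w * y" "w * y \<le> y"
      using that assms by (auto simp: y_def mult_left_le_one_le mult_nonneg_nonpos)
    then show ?thesis
      using cosh_real_nonneg_le_iff[of "w * y" y] by simp
  qed
  then have *: "cnj (csqrt_plus (cosh (of_real y) - cosh (of_real w * of_real y))) =
      csqrt_plus (cosh (of_real y) - cosh (of_real w * of_real y))"
    if "w \<in> {0..1}" for w :: real
    using that s_r[of "cosh y - cosh (w * y)"] by (simp add: cosh_r flip: of_real_mult of_real_diff)
  have "cnj (G_Q1 \<sigma> (of_real y)) = G_Q1 \<sigma> (of_real y)"
    unfolding G_Q1_altdef complex_cnj_mult integral_cnj
    using * h_r[of "_ * y"] by (auto simp: sinh_r intro!: integral_cong)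
  then show ?thesis
    by (simp add: y_def)
qed

end

theory Submission
  imports Defs
begin

text \<open>
  Since \<open>cosh u - cosh s = 2 sinh ((u + s) / 2) sinh ((u - s) / 2)\<close> and \<open>sinh z / z\<close> avoids the
  branch cut of the principal square root on the strip, the factor \<open>\<surd>(u\<^sup>2 (1 - w\<^sup>2) / 2)\<close>
  can be split off from the square root at \<open>s = w u\<close>. It cancels against the factor \<open>u\<close> of the
  path, and the remaining weight \<open>1 / \<surd>(1 - w\<^sup>2)\<close> disappears under \<open>w = sin t\<close>. This yields a
  function that is visibly holomorphic on the whole strip, is odd and commutes with conjugation;
  these symmetries are the ones by which \<open>G\<close> is extended from \<open>Q1\<close>.
\<close>

section \<open>The quotient \<open>sinh z / z\<close> and its reciprocal square root on the
  strip\<close>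

definition sinhc :: "complex \<Rightarrow> complex" where
  "sinhc z = (if z = 0 then 1 else sinh z / z)"

lemma sinh_eq_mult_sinhc: "sinh z = z * sinhc z"
  by (simp add: sinhc_def)

lemma sinhc_minus [simp]: "sinhc (- z) = sinhc z"
  by (simp add: sinhc_def)

lemma cnj_sinh: "cnj (sinh z) = sinh (cnj z)"
  by (simp add: sinh_field_def exp_cnj)

lemma cnj_sinhc: "cnj (sinhc z) = sinhc (cnj z)"
  by (simp add: sinhc_def cnj_sinh)

lemma holomorphic_sinh: "(sinh :: complex \<Rightarrow> complex) holomorphic_on A"
  unfolding sinh_def scaleR_conv_of_real by (intro holomorphic_intros)

text \<open>This is the difference quotient of \<open>sinh\<close> at 0, completed there by the
  derivative, so \<open>pole_lemma\<close> removes the singularity.\<close>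

lemma holomorphic_on_sinhc: "sinhc holomorphic_on A"
proof -
  have "(sinh has_field_derivative 1) (at (0 :: complex))"
    by (auto intro!: derivative_eq_intros)
  then have "deriv sinh (0 :: complex) = 1"
    by (rule DERIV_imp_deriv)
  then have "sinhc = (\<lambda>z. if z = 0 then deriv sinh 0 else (sinh z - sinh 0) / (z - 0))"
    by (auto simp: sinhc_def fun_eq_iff)
  moreover have "\<dots> holomorphic_on UNIV"
    by (rule pole_lemma) (auto intro: holomorphic_sinh)
  ultimately show ?thesis
    using holomorphic_on_subset by (metis top_greatest)
qed

lemma Im_sinh: "Im (sinh z) = cosh (Re z) * sin (Im z)"
  by (simp add: sinh_field_def Im_exp cosh_field_def algebra_simps add_divide_distrib)

lemma sinh_of_real: "sinh (complex_of_real x) = of_real (sinh x)"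
  by (simp add: sinh_field_def exp_of_real flip: of_real_minus)

lemma sinhc_of_real: "sinhc (of_real x) = of_real (if x = 0 then 1 else sinh x / x)"
  by (simp add: sinhc_def sinh_of_real)

lemma sinh_div_self_pos: "x \<noteq> 0 \<Longrightarrow> sinh x / x > (0 :: real)"
  by (cases "x > 0") (auto simp: zero_less_divide_iff)

text \<open>If \<open>sinh z = c * z\<close> with \<open>c\<close> real and nonpositive, compare
  imaginary parts: \<open>cosh (Re z) * sin (Im z) = c * Im z\<close>. For 0 < |Im z| < pi the left
  side has the strict sign of \<open>Im z\<close>, which the right side cannot have. On the real
  axis the quotient is positive outright.\<close>

lemma sinhc_not_nonpos:
  assumes "\<bar>Im z\<bar> < pi"
  shows "sinhc z \<notin> \<real>\<^sub>\<le>\<^sub>0"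
proof
  assume "sinhc z \<in> \<real>\<^sub>\<le>\<^sub>0"
  then obtain c where c: "c \<le> 0" "sinhc z = of_real c"
    by (auto elim!: nonpos_Reals_cases)
  show False
  proof (cases "Im z = 0")
    case True
    then have "z = of_real (Re z)"
      by (simp add: complex_eq_iff)
    with c(2) have "of_real c = complex_of_real (if Re z = 0 then 1 else sinh (Re z) / Re z)"
      by (metis sinhc_of_real)
    with c(1) show False
      using sinh_div_self_pos[of "Re z"] unfolding of_real_eq_iff by (auto split: if_splits)
  next
    case False
    have eq: "cosh (Re z) * sin (Im z) = Im z * c"
      using sinh_eq_mult_sinhc[of z] by (simp add: Im_sinh c flip: Im_sinh)
    show False
    proof (cases "Im z > 0")
      case True
      then have "cosh (Re z) * sin (Im z) > 0"
        using assms by (auto intro!: mult_pos_pos sin_gt_zero)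
      moreover have "Im z * c \<le> 0"
        using True c by (simp add: mult_nonneg_nonpos)
      ultimately show False using eq by simp
    next
      case 2: False
      then have "sin (- Im z) > 0"
        using assms False by (intro sin_gt_zero) auto
      then have "cosh (Re z) * sin (Im z) < 0"
        by (simp add: mult_pos_neg)
      moreover have "Im z * c \<ge> 0"
        using 2 c by (simp add: mult_nonpos_nonpos)
      ultimately show False using eq by simp
    qed
  qed
qed

definition inv_sqrt_sinhc :: "complex \<Rightarrow> complex" where
  "inv_sqrt_sinhc z = 1 / csqrt (sinhc z)"

lemma holomorphic_on_inv_sqrt_sinhc: "inv_sqrt_sinhc holomorphic_on {z. \<bar>Im z\<bar> < pi}"
  unfolding inv_sqrt_sinhc_def
  using sinhc_not_nonpos by (force intro!: holomorphic_intros holomorphic_on_sinhc)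

lemma inv_sqrt_sinhc_minus [simp]: "inv_sqrt_sinhc (- z) = inv_sqrt_sinhc z"
  by (simp add: inv_sqrt_sinhc_def)

text \<open>Conjugation does not commute with \<open>csqrt\<close> on the negative reals; the strip
  condition keeps \<open>sinhc z\<close> away from them.\<close>

lemma cnj_inv_sqrt_sinhc: "\<bar>Im z\<bar> < pi \<Longrightarrow> cnj (inv_sqrt_sinhc z) = inv_sqrt_sinhc (cnj z)"
  by (simp add: inv_sqrt_sinhc_def cnj_csqrt sinhc_not_nonpos cnj_sinhc)

section \<open>Symmetries of \<open>hfun\<close> and holomorphy of parameter integrals\<close>

lemma hfun_minus [simp]: "hfun \<sigma> (- s) = hfun \<sigma> s"
  by (simp add: hfun_def)

lemma cnj_hfun: "cnj (hfun \<sigma> s) = hfun \<sigma> (cnj s)"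
proof -
  have "sinh (cnj s) = 0 \<longleftrightarrow> sinh s = 0"
    by (metis cnj_sinh complex_cnj_zero_iff)
  then show ?thesis
    by (simp add: hfun_def cnj_sinh cnj_sin)
qed

text \<open>Differentiation under the integral sign, shaped for an integrand with three factors,
  each with its own scaling of \<open>u\<close>. Convexity and \<open>0 \<in> V\<close> keep the
  scaled arguments inside \<open>V\<close>.\<close>

lemma holomorphic_on_integral_scaled:
  fixes f g h :: "complex \<Rightarrow> complex" and p q r :: "real \<Rightarrow> real"
  assumes V: "open V" "convex V" "0 \<in> V"
    and hol: "f holomorphic_on V" "g holomorphic_on V" "h holomorphic_on V"
    and cont: "continuous_on {a..b} p" "continuous_on {a..b} q" "continuous_on {a..b} r"
    and bnd: "\<And>t. t \<in> {a..b} \<Longrightarrow> p t \<in> {0..1} \<and> q t \<in> {0..1} \<and> r t \<in> {0..1}"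
  shows "(\<lambda>u. integral {a..b} (\<lambda>t. f (of_real (p t) * u) * g (of_real (q t) * u) * h (of_real (r t) * u)))
    holomorphic_on V"
proof -
  have scale: "of_real c * u \<in> V" if "u \<in> V" "c \<in> {0..1}" for c u
    using convexD_alt[OF V(2,3) that(1), of c] that(2) by (simp add: scaleR_conv_of_real)
  have der: "((\<lambda>u. k (of_real c * u)) has_field_derivative (of_real c * deriv k (of_real c * u))) (at u within V)"
    if "k holomorphic_on V" "u \<in> V" "c \<in> {0..1}" for k c u
  proof -
    have "(k has_field_derivative deriv k (of_real c * u)) (at (of_real c * u))"
      using holomorphic_derivI[OF that(1) V(1) scale[OF that(2,3)]] .
    then have "((\<lambda>u. k (of_real c * u)) has_field_derivative
        deriv k (of_real c * u) * of_real c) (at u within V)"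
      by (rule DERIV_chain2) (auto intro!: derivative_eq_intros)
    then show ?thesis
      by (simp add: mult.commute)
  qed
  have cont_scaled: "continuous_on (V \<times> {a..b}) (\<lambda>x. k (of_real (c (snd x)) * fst x))"
    if "k holomorphic_on V" "continuous_on {a..b} c" "\<And>t. t \<in> {a..b} \<Longrightarrow> c t \<in> {0..1}"
    for k and c :: "real \<Rightarrow> real"
  proof (rule continuous_on_compose2[OF holomorphic_on_imp_continuous_on[OF that(1)]])
    show "continuous_on (V \<times> {a..b}) (\<lambda>x. of_real (c (snd x)) * fst x)"
      by (intro continuous_intros continuous_on_compose2[OF that(2)]) auto
  qed (use scale that(3) in auto)
  have cont_fixed: "continuous_on {a..b} (\<lambda>t. k (of_real (c t) * u))"
    if "u \<in> V" "k holomorphic_on V" "continuous_on {a..b} c" "\<And>t. t \<in> {a..b} \<Longrightarrow> c t \<in> {0..1}"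
    for k u and c :: "real \<Rightarrow> real"
    using that scale
    by (intro continuous_on_compose2[OF holomorphic_on_imp_continuous_on[OF that(2)]] continuous_intros) auto
  have cont_p: "continuous_on (V \<times> {a..b}) (\<lambda>x. complex_of_real (c (snd x)))"
    if "continuous_on {a..b} c" for c :: "real \<Rightarrow> real"
    by (intro continuous_intros continuous_on_compose2[OF that]) auto
  note dhol = hol[THEN holomorphic_deriv, OF V(1)]
  have "(\<lambda>u. integral (cbox a b)
      (\<lambda>t. f (of_real (p t) * u) * g (of_real (q t) * u) * h (of_real (r t) * u))) holomorphic_on V"
  \<comment> \<open>The derivative is written in exactly the shape that two applications of
    \<open>DERIV_mult\<close> produce.\<close>
  proof (rule leibniz_rule_holomorphic[where fx = "\<lambda>u t.
      (of_real (p t) * deriv f (of_real (p t) * u) * g (of_real (q t) * u)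
        + of_real (q t) * deriv g (of_real (q t) * u) * f (of_real (p t) * u)) * h (of_real (r t) * u)
      + of_real (r t) * deriv h (of_real (r t) * u) * (f (of_real (p t) * u) * g (of_real (q t) * u))"])
    fix u t assume "u \<in> V" and "t \<in> cbox a b"
    then show "((\<lambda>u. f (of_real (p t) * u) * g (of_real (q t) * u) * h (of_real (r t) * u))
      has_field_derivative
      ((of_real (p t) * deriv f (of_real (p t) * u) * g (of_real (q t) * u)
        + of_real (q t) * deriv g (of_real (q t) * u) * f (of_real (p t) * u)) * h (of_real (r t) * u)
      + of_real (r t) * deriv h (of_real (r t) * u) * (f (of_real (p t) * u) * g (of_real (q t) * u))))
      (at u within V)"
      using bnd[of t] by (intro DERIV_mult der hol) auto
  next
    fix u assume "u \<in> V"
    then have "continuous_on {a..b}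
        (\<lambda>t. f (of_real (p t) * u) * g (of_real (q t) * u) * h (of_real (r t) * u))"
      using bnd by (intro continuous_on_mult cont_fixed hol cont) auto
    then show "(\<lambda>t. f (of_real (p t) * u) * g (of_real (q t) * u) * h (of_real (r t) * u))
        integrable_on cbox a b"
      by (simp add: integrable_continuous_interval)
  next
    show "continuous_on (V \<times> cbox a b) (\<lambda>(u, t).
      (of_real (p t) * deriv f (of_real (p t) * u) * g (of_real (q t) * u)
        + of_real (q t) * deriv g (of_real (q t) * u) * f (of_real (p t) * u)) * h (of_real (r t) * u)
      + of_real (r t) * deriv h (of_real (r t) * u) * (f (of_real (p t) * u) * g (of_real (q t) * u)))"
      unfolding case_prod_unfold cbox_interval using bnd
      by (intro continuous_on_add continuous_on_mult cont_scaled cont_p hol dhol cont) auto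
  qed (rule V)
  then show ?thesis by simp
qed

section \<open>The candidate function on the whole strip and its symmetries\<close>

text \<open>For \<open>s = sin t * u\<close>, the last two arguments are \<open>(u + s) / 2\<close>
  and \<open>(u - s) / 2\<close>, the half sum and half difference in the factorization of
  \<open>cosh u - cosh s\<close>.\<close>

definition G_kernel :: "real \<Rightarrow> complex \<Rightarrow> real \<Rightarrow> complex" where
  "G_kernel \<sigma> u t = hfun \<sigma> (of_real (sin t) * u) *
     inv_sqrt_sinhc (of_real ((1 + sin t) / 2) * u) * inv_sqrt_sinhc (of_real ((1 - sin t) / 2) * u)"

text \<open>The constant \<open>sqrt 2\<close> comes from the factor
  \<open>sqrt ((1 - w\<^sup>2) / 2)\<close> in the denominator of the original integrand.\<close>

definition G_strip :: "real \<Rightarrow> complex \<Rightarrow> complex" where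
  "G_strip \<sigma> u = of_real (sqrt 2) * sinh u * integral {0..pi / 2} (G_kernel \<sigma> u)"

lemma sin_mem_unit: "t \<in> {0..pi / 2} \<Longrightarrow> sin t \<in> {0..1}"
  by (auto intro!: sin_ge_zero)

lemma scaled_in_strip:
  assumes "\<bar>Im u\<bar> < pi" "c \<in> {0..1}"
  shows "\<bar>Im (of_real c * u)\<bar> < pi"
proof -
  have "c * \<bar>Im u\<bar> \<le> \<bar>Im u\<bar>"
    using assms by (intro mult_left_le_one_le) auto
  with assms show ?thesis by (simp add: abs_mult)
qed

lemma strip_eq_Int: "{u. \<bar>Im u\<bar> < pi} = {u. Im u < pi} \<inter> {u. Im u > - pi}"
  by auto

lemma holomorphic_on_G_strip: "G_strip \<sigma> holomorphic_on {u. \<bar>Im u\<bar> < pi}"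
proof -
  have "open {u. \<bar>Im u\<bar> < pi}"
    unfolding strip_eq_Int by (intro open_Int open_halfspace_Im_lt open_halfspace_Im_gt)
  moreover have "convex {u. \<bar>Im u\<bar> < pi}"
    unfolding strip_eq_Int by (intro convex_Int convex_halfspace_Im_lt convex_halfspace_Im_gt)
  ultimately have "(\<lambda>u. integral {0..pi / 2} (G_kernel \<sigma> u)) holomorphic_on {u. \<bar>Im u\<bar> < pi}"
    unfolding G_kernel_def using sin_mem_unit
    by (intro holomorphic_on_integral_scaled holomorphic_on_inv_sqrt_sinhc
        holomorphic_on_subset[OF hfun_entire] continuous_intros) auto
  then show ?thesis
    unfolding G_strip_def by (intro holomorphic_intros holomorphic_sinh)
qed

lemma G_strip_minus: "G_strip \<sigma> (- u) = - G_strip \<sigma> u"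
proof -
  have "G_kernel \<sigma> (- u) = G_kernel \<sigma> u"
    by (simp only: G_kernel_def fun_eq_iff mult_minus_right hfun_minus inv_sqrt_sinhc_minus simp_thms)
  then show ?thesis
    by (simp add: G_strip_def)
qed

lemma G_strip_cnj:
  assumes "\<bar>Im u\<bar> < pi"
  shows "G_strip \<sigma> (cnj u) = cnj (G_strip \<sigma> u)"
proof -
  have "cnj (G_kernel \<sigma> u t) = G_kernel \<sigma> (cnj u) t" if "t \<in> {0..pi / 2}" for t
  proof -
    note b = scaled_in_strip[OF assms]
    have "(1 + sin t) / 2 \<in> {0..1}" "(1 - sin t) / 2 \<in> {0..1}"
      using sin_mem_unit[OF that] by auto
    note this[THEN b, THEN cnj_inv_sqrt_sinhc]
    then show ?thesis
      by (simp only: G_kernel_def complex_cnj_mult cnj_hfun complex_cnj_complex_of_real)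
  qed
  then have "integral {0..pi / 2} (\<lambda>t. cnj (G_kernel \<sigma> u t)) = integral {0..pi / 2} (G_kernel \<sigma> (cnj u))"
    by (intro integral_cong)
  then show ?thesis
    by (simp add: G_strip_def cnj_sinh integral_cnj)
qed

section \<open>Identifying the branch of the square root along the segment\<close>

text \<open>The hypothesis describes the range of \<open>csqrt_plus\<close>. If
  \<open>Re z < 0\<close>, then the square lies in the lower half plane and its principal root is
  \<open>- z\<close>; the sign change in \<open>csqrt_plus\<close> restores
  \<open>z\<close>.\<close>

lemma csqrt_plus_power2:
  assumes "Im z > 0 \<or> Im z = 0 \<and> Re z \<ge> 0"
  shows "csqrt_plus (z\<^sup>2) = z"
proof (cases "Re z \<ge> 0")
  case True
  with assms have "csqrt (z\<^sup>2) = z"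
    by (intro csqrt_square) auto
  moreover from True assms have "Im (z\<^sup>2) \<ge> 0"
    by (auto simp: power2_eq_square)
  ultimately show ?thesis by (simp add: csqrt_plus_def)
next
  case False
  with assms have "csqrt ((- z)\<^sup>2) = - z"
    by (intro csqrt_square) auto
  moreover from False assms have "Im (z\<^sup>2) < 0"
    by (auto simp: power2_eq_square mult_pos_neg)
  ultimately show ?thesis by (simp add: csqrt_plus_def)
qed

text \<open>A purely imaginary root would square to a nonpositive real.\<close>

lemma Re_csqrt_pos:
  assumes "z \<notin> \<real>\<^sub>\<le>\<^sub>0"
  shows "Re (csqrt z) > 0"
proof (rule ccontr)
  assume "\<not> Re (csqrt z) > 0"
  then have 0: "Re (csqrt z) = 0"
    using csqrt_principal[of z] by auto
  have "z = (csqrt z)\<^sup>2" by simp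
  also have "\<dots> = - of_real ((Im (csqrt z))\<^sup>2)"
    unfolding complex_eq_iff Re_power2 Im_power2 0 by simp
  finally have "z \<in> \<real>\<^sub>\<le>\<^sub>0"
    by (metis neg_le_0_iff_le nonpos_Reals_of_real_iff of_real_minus zero_le_power2)
  with assms show False by simp
qed

text \<open>
  The product is a square root of \<open>sinh z\<close>, which lies in the upper half plane, and its argument
  is confined to \<open>(- \<pi> / 2, \<pi>)\<close>; so it cannot lie in the third quadrant.
\<close>
lemma csqrt_mult_csqrt_sinhc_first_quadrant:
  assumes "0 < Im z" "Im z < pi"
  shows "Re (csqrt z * csqrt (sinhc z)) > 0" "Im (csqrt z * csqrt (sinhc z)) > 0"
proof -
  define p where "p = csqrt z"
  define q where "q = csqrt (sinhc z)"
  have "(p * q)\<^sup>2 = sinh z"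
    by (simp add: p_def q_def power_mult_distrib sinh_eq_mult_sinhc)
  moreover have "Im (sinh z) > 0"
    unfolding Im_sinh using assms by (intro mult_pos_pos sin_gt_zero) auto
  ultimately have *: "Re (p * q) * Im (p * q) > 0"
    by (metis Im_power2 mult.assoc zero_less_mult_pos zero_less_numeral)
  have p2: "p\<^sup>2 = z" by (simp add: p_def)
  have "Re p \<ge> 0" "Re q > 0"
    using sinhc_not_nonpos[of z] assms csqrt_principal[of z] Re_csqrt_pos[of "sinhc z"]
    by (auto simp: p_def q_def)
  moreover have "Re p * Im p > 0"
    using assms(1) arg_cong[OF p2, of Im] by (simp add: power2_eq_square mult.commute)
  ultimately have p: "Re p > 0" "Im p > 0"
    by (auto simp: zero_less_mult_iff)
  have "\<not> (Re (p * q) < 0 \<and> Im (p * q) < 0)"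
  proof
    assume neg: "Re (p * q) < 0 \<and> Im (p * q) < 0"
    have pos: "Re p * Re q > 0" "Im p * Re q > 0"
      using p \<open>Re q > 0\<close> by auto
    have "Im p * Im q > 0"
      using neg pos by simp
    moreover have "Re p * Im q < 0"
      using neg pos by simp
    ultimately show False
      using p by (auto simp: zero_less_mult_iff mult_less_0_iff)
  qed
  with * show "Re (csqrt z * csqrt (sinhc z)) > 0" "Im (csqrt z * csqrt (sinhc z)) > 0"
    unfolding p_def q_def by (auto simp: zero_less_mult_iff)
qed

lemma csqrt_of_real_mult:
  assumes "r \<ge> 0"
  shows "csqrt (of_real r * z) = of_real (sqrt r) * csqrt z"
proof (cases "r = 0")
  case False
  have "csqrt ((of_real (sqrt r) * csqrt z)\<^sup>2) = of_real (sqrt r) * csqrt z"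
    using csqrt_principal[of z] False assms by (intro csqrt_square) auto
  then show ?thesis
    using assms by (simp add: power_mult_distrib flip: of_real_power)
qed simp

text \<open>The right side squares to \<open>cosh u - cosh (of_real w * u)\<close> by the addition
  formulas. What remains is the sign, which \<open>csqrt_plus_power2\<close> settles once the right
  side is known to lie in the range of \<open>csqrt_plus\<close>.\<close>

lemma csqrt_plus_cosh_diff:
  assumes u: "Im u \<in> {0<..<pi} \<or> Im u = 0 \<and> Re u \<ge> 0" and w: "0 \<le> w" "w < 1"
  shows "csqrt_plus (cosh u - cosh (of_real w * u)) = of_real (sqrt ((1 - w\<^sup>2) / 2)) * u *
    csqrt (sinhc (of_real ((1 + w) / 2) * u)) * csqrt (sinhc (of_real ((1 - w) / 2) * u))"
proof -
  define a where "a = of_real ((1 + w) / 2) * u"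
  define b where "b = of_real ((1 - w) / 2) * u"
  define T where "T = of_real (sqrt ((1 - w\<^sup>2) / 2)) * u * csqrt (sinhc a) * csqrt (sinhc b)"
  have w2: "1 - w\<^sup>2 > 0"
    using w by (simp add: power_less_one_iff abs_square_less_1)
  have ab: "u = a + b" "of_real w * u = a - b"
    by (simp_all add: a_def b_def field_simps)
  have "cosh u - cosh (of_real w * u) = 2 * sinh a * sinh b"
    \<comment> \<open>The product \<open>of_real w * u\<close> must be rewritten before the
      \<open>u\<close> inside it is replaced.\<close>
    unfolding ab(2) unfolding ab(1) cosh_add cosh_diff by simp
  also have "\<dots> = 2 * a * b * sinhc a * sinhc b"
    by (simp add: sinh_eq_mult_sinhc)
  also have "2 * a * b = of_real ((1 - w\<^sup>2) / 2) * u\<^sup>2"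
    by (simp add: a_def b_def power2_eq_square field_simps)
  also have "of_real ((1 - w\<^sup>2) / 2) = (complex_of_real (sqrt ((1 - w\<^sup>2) / 2)))\<^sup>2"
    using w2 by (subst of_real_power[symmetric]) simp
  finally have T2: "cosh u - cosh (of_real w * u) = T\<^sup>2"
    by (simp add: T_def power_mult_distrib)
  have "Im T > 0 \<or> Im T = 0 \<and> Re T \<ge> 0"
    using u
  proof
    assume im: "Im u \<in> {0<..<pi}"
    have bounds: "0 < Im a" "Im a < pi" "0 < Im b" "Im b < pi"
      using im w scaled_in_strip[of u "(1 + w) / 2"] scaled_in_strip[of u "(1 - w) / 2"]
      by (auto simp: a_def b_def abs_less_iff)
    note pos = csqrt_mult_csqrt_sinhc_first_quadrant[OF bounds(1,2)]
      csqrt_mult_csqrt_sinhc_first_quadrant[OF bounds(3,4)]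
    \<comment> \<open>The real factor is split so that \<open>T\<close> becomes
      \<open>sqrt 2\<close> times a product of two numbers in the open first quadrant, one built
      from \<open>a\<close> and one from \<open>b\<close>; such a product has positive imaginary
      part.\<close>
    have "sqrt 2 * (sqrt ((1 + w) / 2) * sqrt ((1 - w) / 2)) = sqrt (2 * ((1 + w) / 2 * ((1 - w) / 2)))"
      by (simp only: real_sqrt_mult)
    also have "2 * ((1 + w) / 2 * ((1 - w) / 2)) = (1 - w\<^sup>2) / 2"
      by (simp add: power2_eq_square field_simps)
    finally have rt: "sqrt 2 * (sqrt ((1 + w) / 2) * sqrt ((1 - w) / 2)) = sqrt ((1 - w\<^sup>2) / 2)" .
    have "csqrt a * csqrt b = of_real (sqrt ((1 + w) / 2) * sqrt ((1 - w) / 2)) * (csqrt u)\<^sup>2"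
      unfolding a_def b_def using w
      by (subst (1 2) csqrt_of_real_mult) (simp_all only: power2_eq_square of_real_mult mult_ac, auto)
    then have "T = of_real (sqrt 2) * ((csqrt a * csqrt (sinhc a)) * (csqrt b * csqrt (sinhc b)))"
      unfolding T_def rt[symmetric] of_real_mult by simp
    then have "Im T = sqrt 2 * Im ((csqrt a * csqrt (sinhc a)) * (csqrt b * csqrt (sinhc b)))"
      by simp
    moreover have "Im ((csqrt a * csqrt (sinhc a)) * (csqrt b * csqrt (sinhc b))) > 0"
      using pos by (subst times_complex.sel) (intro add_pos_pos mult_pos_pos)
    ultimately show ?thesis by simp
  next
    assume real: "Im u = 0 \<and> Re u \<ge> 0"
    then have "u = of_real (Re u)"
      by (simp add: complex_eq_iff)
    then obtain x where x: "u = of_real x" "x \<ge> 0"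
      using real by blast
    have "\<exists>y\<ge>0. csqrt (sinhc (of_real r)) = of_real y" for r
      unfolding sinhc_of_real using sinh_div_self_pos[of r]
      by (intro exI[of _ "sqrt (if r = 0 then 1 else sinh r / r)"])
        (auto simp del: of_real_divide simp: csqrt_of_real_nonneg)
    then obtain y z where "csqrt (sinhc a) = of_real y" "y \<ge> 0" "csqrt (sinhc b) = of_real z" "z \<ge> 0"
      unfolding a_def b_def x of_real_mult[symmetric] by metis
    then have "T = of_real (sqrt ((1 - w\<^sup>2) / 2) * x * y * z)"
      by (simp add: T_def x)
    then show ?thesis
      using \<open>x \<ge> 0\<close> \<open>y \<ge> 0\<close> \<open>z \<ge> 0\<close> w2 by simp
  qed
  then show ?thesis
    unfolding T2 by (subst csqrt_plus_power2) (simp_all add: T_def a_def b_def)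
qed

section \<open>Agreement with \<open>G_Q1\<close> by substitution, then on all four pieces\<close>

text \<open>The substitution is \<open>t = arcsin w\<close>. The hypothesis admits the whole open
  upper half of the strip, so the sign of \<open>Re u\<close> matters only on the real axis.\<close>

lemma G_Q1_eq_G_strip:
  assumes u: "Im u \<in> {0<..<pi} \<or> Im u = 0 \<and> Re u \<ge> 0"
  shows "G_Q1 \<sigma> u = G_strip \<sigma> u"
proof (cases "u = 0")
  case True
  then show ?thesis by (simp add: G_Q1_def G_strip_def)
next
  case False
  have strip: "\<bar>Im u\<bar> < pi" using u by auto
  have cont: "continuous_on {0..pi / 2} (\<lambda>t. f (of_real (c t) * u))"
    if "f holomorphic_on {u. \<bar>Im u\<bar> < pi}" "continuous_on {0..pi / 2} c"
      "\<And>t. t \<in> {0..pi / 2} \<Longrightarrow> c t \<in> {0..1}"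
    for f :: "complex \<Rightarrow> complex" and c :: "real \<Rightarrow> real"
  proof (rule continuous_on_compose2[OF holomorphic_on_imp_continuous_on[OF that(1)]])
    show "continuous_on {0..pi / 2} (\<lambda>t. of_real (c t) * u)"
      by (intro continuous_intros that)
    show "(\<lambda>t. of_real (c t) * u) ` {0..pi / 2} \<subseteq> {u. \<bar>Im u\<bar> < pi}"
      using scaled_in_strip[OF strip that(3)] by blast
  qed
  have "continuous_on {0..pi / 2} (G_kernel \<sigma> u)"
    unfolding G_kernel_def using sin_mem_unit
    by (intro continuous_on_mult cont holomorphic_on_inv_sqrt_sinhc
        holomorphic_on_subset[OF hfun_entire] continuous_intros) auto
  \<comment> \<open>At 1 the derivative of \<open>arcsin\<close> blows up;
    \<open>has_integral_substitution_strong\<close> allows this point as a finite exceptional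
    set.\<close>
  moreover have "(arcsin has_field_derivative inverse (sqrt (1 - w\<^sup>2))) (at w within {0..1})"
    if "w \<in> {0..1} - {1}" for w
    using that by (intro has_field_derivative_at_within[OF DERIV_arcsin]) auto
  moreover have "arcsin ` {0..1} \<subseteq> {0..pi / 2}"
    using arcsin_le_arcsin[of 0] arcsin_ubound by force
  ultimately have "((\<lambda>w. inverse (sqrt (1 - w\<^sup>2)) *\<^sub>R G_kernel \<sigma> u (arcsin w)) has_integral
      (integral {arcsin 0..arcsin 1} (G_kernel \<sigma> u))) {0..1}"
    by (intro has_integral_substitution_strong[where s = "{1}" and c = 0 and d = "pi / 2"])
      (auto intro!: continuous_intros)
  \<comment> \<open>The quotient by \<open>u\<close> will cancel against the factor \<open>u\<close>
    in \<open>G_Q1_altdef\<close>.\<close>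
  then have "((\<lambda>w. (of_real (sqrt 2) / u) * (inverse (sqrt (1 - w\<^sup>2)) *\<^sub>R G_kernel \<sigma> u (arcsin w)))
      has_integral (of_real (sqrt 2) / u) * integral {0..pi / 2} (G_kernel \<sigma> u)) {0..1}"
    by (intro has_integral_mult_right) simp
  then have "((\<lambda>w. hfun \<sigma> (of_real w * u) / csqrt_plus (cosh u - cosh (of_real w * u)))
      has_integral (of_real (sqrt 2) / u) * integral {0..pi / 2} (G_kernel \<sigma> u)) {0..1}"
  \<comment> \<open>The endpoint is discarded because \<open>csqrt_plus_cosh_diff\<close> covers
    only \<open>w < 1\<close>.\<close>
  proof (rule has_integral_spike_finite[where S = "{1}", rotated 2])
    fix w :: real assume "w \<in> {0..1} - {1}"
    then have w: "0 \<le> w" "w < 1" by auto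
    show "hfun \<sigma> (of_real w * u) / csqrt_plus (cosh u - cosh (of_real w * u)) =
        (of_real (sqrt 2) / u) * (inverse (sqrt (1 - w\<^sup>2)) *\<^sub>R G_kernel \<sigma> u (arcsin w))"
      unfolding csqrt_plus_cosh_diff[OF u w] G_kernel_def inv_sqrt_sinhc_def
      using w by (simp add: scaleR_conv_of_real real_sqrt_divide divide_simps)
  qed simp
  then show ?thesis
    using False by (simp add: G_Q1_altdef G_strip_def integral_unique)
qed

lemma Im_nonneg_of_mem_Q12:
  assumes "u \<in> Q1 \<union> Q2"
  shows "0 \<le> Im u" "Im u < pi"
  using assms Arg_less_0[of u] pi_gt_zero by (auto simp: Q1_def Q2_def)

text \<open>Each reflection in the definition of \<open>G\<close> carries its piece into the region
  of \<open>G_Q1_eq_G_strip\<close>; oddness and conjugation symmetry of \<open>G_strip\<close> then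
  undo the reflection.\<close>

lemma G_eq_G_strip:
  assumes "\<bar>Im u\<bar> < pi"
  shows "G \<sigma> u = G_strip \<sigma> u"
proof -
  consider "u \<in> Q1" | "u \<notin> Q1" "u \<in> Q2" | "u \<notin> Q1" "u \<notin> Q2" "u \<in> Q3"
    | "u \<notin> Q1" "u \<notin> Q2" "u \<notin> Q3" "u \<in> Q4"
    using assms strip_eq_Q by blast
  then show ?thesis
  proof cases
    case 1
    \<comment> \<open>Negative reals have argument \<open>pi\<close>, hence are not in
      \<open>Q1\<close>.\<close>
    have "Re u \<ge> 0" if "Im u = 0"
      using 1 that Arg_eq_pi[of u] by (force simp: Q1_def)
    then have "G_Q1 \<sigma> u = G_strip \<sigma> u"
      using Im_nonneg_of_mem_Q12[of u] 1 by (intro G_Q1_eq_G_strip) auto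
    with 1 show ?thesis by (simp add: G_def)
  next
    case 2
    \<comment> \<open>Nonnegative reals have argument 0, hence are not in \<open>Q2\<close>.\<close>
    have "Re u \<le> 0" if "Im u = 0"
      using 2 that Arg_eq_0_iff[of u] pi_gt_zero by (force simp: Q2_def complex_is_Real_iff)
    then have "G_Q1 \<sigma> (- cnj u) = G_strip \<sigma> (- cnj u)"
      using Im_nonneg_of_mem_Q12[of u] 2 by (intro G_Q1_eq_G_strip) auto
    with 2 assms show ?thesis by (simp add: G_def G_strip_minus G_strip_cnj)
  next
    case 3
    \<comment> \<open>A negative \<open>Arg\<close> excludes the real axis, so the reflected point
      lies in the open upper half of the strip; the same holds for \<open>Q4\<close>.\<close>
    then have "Im u < 0"
      using pi_gt_zero by (auto simp: Q3_def simp flip: Arg_neg_iff)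
    then have "G_Q1 \<sigma> (- u) = G_strip \<sigma> (- u)"
      using assms by (intro G_Q1_eq_G_strip) auto
    with 3 show ?thesis by (simp add: G_def G_strip_minus)
  next
    case 4
    then have "Im u < 0"
      by (auto simp: Q4_def simp flip: Arg_neg_iff)
    then have "G_Q1 \<sigma> (cnj u) = G_strip \<sigma> (cnj u)"
      using assms by (intro G_Q1_eq_G_strip) auto
    with 4 assms show ?thesis by (simp add: G_def G_strip_cnj)
  qed
qed

theorem theorem2:
  fixes \<sigma>\<^sub>0 :: real
  assumes "\<sigma>\<^sub>0 > 0"
  shows "G \<sigma>\<^sub>0 holomorphic_on {u. \<bar>Im u\<bar> < pi}"
  using holomorphic_on_G_strip[of "\<sigma>\<^sub>0"]
  by (rule holomorphic_transform) (simp add: G_eq_G_strip)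

end
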